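(* Let $\mathfrak g$ be a finite-dimensional Lie algebra over a field $k$ of characteristic zero. If $\mathfrak g$ admits an LR-structure, then $\mathfrak g$ also admits a complete LR-structure.
   Context: An LR-algebra is a vector space $A$ with a bilinear product $\cdot$ satisfying $x\cdot(y\cdot z)=y\cdot(x\cdot z)$ and $(x\cdot y)\cdot z=(x\cdot z)\cdot y$ for all $x,y,z\in A$. An LR-structure on a Lie algebra $\mathfrak g$ is an LR-algebra product on the underlying vector space of $\mathfrak g$ such that $x\cdot y-y\cdot x=[x,y]$ for all $x,y$. An LR-structure is complete if all right multiplications $R(x)\colon y\mapsto y\cdot x$ are nilpotent. *)

theory Defs
  imports Main "HOL.Vector_Spaces"
begin

definition bilinear_map :: "('k::field \<Rightarrow> 'v::ab_group_add \<Rightarrow> 'v) \<Rightarrow> ('v \<Rightarrow> 'v \<Rightarrow> 'v) \<Rightarrow> bool" where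
  "bilinear_map scale p \<longleftrightarrow>
     (\<forall>x. Vector_Spaces.linear scale scale (p x)) \<and> (\<forall>y. Vector_Spaces.linear scale scale (\<lambda>x. p x y))"

definition finite_dim_space :: "('k::field \<Rightarrow> 'v::ab_group_add \<Rightarrow> 'v) \<Rightarrow> bool" where
  "finite_dim_space scale \<longleftrightarrow> vector_space scale \<and>
     (\<exists>B. finite B \<and> module.span scale B = UNIV)"

definition lie_algebra :: "('k::field \<Rightarrow> 'v::ab_group_add \<Rightarrow> 'v) \<Rightarrow> ('v \<Rightarrow> 'v \<Rightarrow> 'v) \<Rightarrow> bool" where
  "lie_algebra scale br \<longleftrightarrow> vector_space scale \<and> bilinear_map scale br \<and>
     (\<forall>x. br x x = 0) \<and>
     (\<forall>x y z. br x (br y z) + br y (br z x) + br z (br x y) = 0)"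

definition LR_algebra :: "('k::field \<Rightarrow> 'v::ab_group_add \<Rightarrow> 'v) \<Rightarrow> ('v \<Rightarrow> 'v \<Rightarrow> 'v) \<Rightarrow> bool" where
  "LR_algebra scale p \<longleftrightarrow> bilinear_map scale p \<and>
     (\<forall>x y z. p x (p y z) = p y (p x z)) \<and>
     (\<forall>x y z. p (p x y) z = p (p x z) y)"

definition LR_structure :: "('k::field \<Rightarrow> 'v::ab_group_add \<Rightarrow> 'v) \<Rightarrow> ('v \<Rightarrow> 'v \<Rightarrow> 'v) \<Rightarrow> ('v \<Rightarrow> 'v \<Rightarrow> 'v) \<Rightarrow> bool" where
  "LR_structure scale br p \<longleftrightarrow> LR_algebra scale p \<and> (\<forall>x y. p x y - p y x = br x y)"

definition nilpotent_map :: "('v::zero \<Rightarrow> 'v) \<Rightarrow> bool" where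
  "nilpotent_map f \<longleftrightarrow> (\<exists>n. \<forall>y. (f ^^ n) y = 0)"

definition complete_LR_structure :: "('k::field \<Rightarrow> 'v::ab_group_add \<Rightarrow> 'v) \<Rightarrow> ('v \<Rightarrow> 'v \<Rightarrow> 'v) \<Rightarrow> ('v \<Rightarrow> 'v \<Rightarrow> 'v) \<Rightarrow> bool" where
  "complete_LR_structure scale br p \<longleftrightarrow> LR_structure scale br p \<and>
     (\<forall>x. nilpotent_map (\<lambda>y. p y x))"

end

theory Submission
  imports Defs
begin

text \<open>
  Products in an LR-algebra \<open>A\<close> commute with each other, and on their span \<open>A\<^sup>2\<close> every left
  multiplication commutes with every right multiplication. Let \<open>A = A\<^sub>0 \<oplus> A\<^sub>1\<close> be the Fitting
  decomposition for the commuting family of right multiplications, with \<open>A\<^sub>0\<close> the part on which all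
  of them are nilpotent. Then \<open>A\<^sub>1\<close> lies in \<open>A\<^sup>2\<close>, hence is a commutative two-sided ideal, and \<open>A\<^sub>0\<close>
  is a right ideal; therefore \<open>A\<^sub>0 \<cdot> A\<^sub>1\<close> lies in \<open>A\<^sub>0 \<inter> A\<^sub>1\<close> and vanishes. The complete structure keeps
  the product on \<open>A\<^sub>0\<close>, is zero on \<open>A\<^sub>1 \<times> A\<close>, and is \<open>- c \<cdot> x\<close> at \<open>(x, c)\<close> in \<open>A\<^sub>0 \<times> A\<^sub>1\<close>.
\<close>

section \<open>Stabilization of monotone chains of subspaces\<close>

context finite_dimensional_vector_space
begin

lemma decseq_subspaces_stabilize:
  assumes sub: "\<And>n. subspace (S n)" and dec: "\<And>n. S (Suc n) \<subseteq> S n"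
  shows "\<exists>N. \<forall>n\<ge>N. S n = S N"
proof -
  have mono: "S n \<subseteq> S m" if "m \<le> n" for m n
    using lift_Suc_antimono_le[of S] dec that by blast
  obtain N where N: "\<And>n. dim (S N) \<le> dim (S n)"
    using ex_has_least_nat[of "\<lambda>_. True" 0 "\<lambda>n. dim (S n)"] by auto
  have "S n = S N" if "n \<ge> N" for n
    using subspace_dim_equal[OF sub sub mono[OF that] N] .
  then show ?thesis by blast
qed

lemma incseq_subspaces_stabilize:
  assumes sub: "\<And>n. subspace (S n)" and inc: "\<And>n. S n \<subseteq> S (Suc n)"
  shows "\<exists>N. \<forall>n\<ge>N. S n = S N"
proof -
  have mono: "S m \<subseteq> S n" if "m \<le> n" for m n
    using lift_Suc_mono_le[of S] inc that by blast
  have "\<forall>n. dim (S n) < Suc dimension"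
    by (simp add: dim_subset_UNIV less_Suc_eq_le)
  then obtain N where N: "\<And>n. dim (S n) \<le> dim (S N)"
    using ex_has_greatest_nat[of "\<lambda>_. True" 0 "\<lambda>n. dim (S n)" "Suc dimension"] by auto
  have "S n = S N" if "n \<ge> N" for n
    using subspace_dim_equal[OF sub sub mono[OF that] N] by simp
  then show ?thesis by blast
qed

end

section \<open>Identities in LR-algebras\<close>

locale finite_dim_LR_algebra = finite_dimensional_vector_space scale Basis
  for scale :: "'k::field \<Rightarrow> 'v::ab_group_add \<Rightarrow> 'v" and Basis +
  fixes mult :: "'v \<Rightarrow> 'v \<Rightarrow> 'v"  (infixl "\<cdot>" 70)
  assumes add_left: "(x + y) \<cdot> z = x \<cdot> z + y \<cdot> z"
    and add_right: "x \<cdot> (y + z) = x \<cdot> y + x \<cdot> z"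
    and scale_left: "scale c x \<cdot> y = scale c (x \<cdot> y)"
    and scale_right: "x \<cdot> scale c y = scale c (x \<cdot> y)"
    and left_comm: "x \<cdot> (y \<cdot> z) = y \<cdot> (x \<cdot> z)"
    and right_comm: "x \<cdot> y \<cdot> z = x \<cdot> z \<cdot> y"
begin

lemma zero_left [simp]: "0 \<cdot> x = 0"
  using add_left[of 0 0 x] by simp

lemma zero_right [simp]: "x \<cdot> 0 = 0"
  using add_right[of x 0 0] by simp

lemma minus_left: "(- x) \<cdot> y = - (x \<cdot> y)"
  using add_left[of x "- x" y] by (simp add: eq_neg_iff_add_eq_0 add.commute)

text \<open>Moving \<open>c\<close> out, swapping \<open>b\<close> with \<open>d\<close> by
  \<open>right_comm\<close> and moving \<open>c\<close> back in exchanges the two right factors. The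
  mirror argument exchanges the left factors, and together they swap the products.\<close>

lemma products_commute: "(a \<cdot> b) \<cdot> (c \<cdot> d) = (c \<cdot> d) \<cdot> (a \<cdot> b)"
proof -
  have 1: "(a \<cdot> b) \<cdot> (c \<cdot> d) = (a \<cdot> d) \<cdot> (c \<cdot> b)" for a b c d
    by (metis left_comm right_comm)
  have 2: "(a \<cdot> b) \<cdot> (c \<cdot> d) = (c \<cdot> b) \<cdot> (a \<cdot> d)" for a b c d
    by (metis left_comm right_comm)
  show ?thesis
    by (metis 1 2)
qed

definition square :: "'v set"
  where "square = span {a \<cdot> b | a b. True}"

lemma subspace_square: "subspace square"
  by (simp add: square_def)

lemma product_in_square: "a \<cdot> b \<in> square"
  unfolding square_def by (rule span_base) blast

lemma subspace_commutant: "subspace {u. u \<cdot> v = v \<cdot> u}"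
  by (auto simp: subspace_def add_left add_right scale_left scale_right)

lemma square_commute:
  assumes "u \<in> square" "v \<in> square"
  shows "u \<cdot> v = v \<cdot> u"
proof -
  have prod: "u \<cdot> (c \<cdot> d) = (c \<cdot> d) \<cdot> u" for c d
    using span_minimal[OF _ subspace_commutant[of "c \<cdot> d"], of "{a \<cdot> b | a b. True}"]
      assms(1) products_commute unfolding square_def by blast
  have "square \<subseteq> {v. v \<cdot> u = u \<cdot> v}"
    unfolding square_def by (rule span_minimal[OF _ subspace_commutant]) (auto simp: prod)
  then show ?thesis
    using assms(2) by auto
qed

text \<open>
  On all of \<open>A\<close> the commutator of \<open>L(x)\<close> and \<open>R(y)\<close> is \<open>R(x \<cdot> y) - L(x \<cdot> y)\<close>, which vanishes
  on \<open>A\<^sup>2\<close> because \<open>x \<cdot> y\<close> lies in \<open>A\<^sup>2\<close>.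
\<close>

lemma left_right_commute_on_square:
  assumes "u \<in> square"
  shows "x \<cdot> (u \<cdot> y) = (x \<cdot> u) \<cdot> y"
  by (metis assms left_comm product_in_square right_comm square_commute)

section \<open>Powers of right multiplications and the Fitting decomposition\<close>

abbreviation rpow :: "'v \<Rightarrow> nat \<Rightarrow> 'v \<Rightarrow> 'v"
  where "rpow y n \<equiv> (\<lambda>v. v \<cdot> y) ^^ n"

lemma rpow_zero [simp]: "rpow y n 0 = 0"
  by (induction n) auto

lemma rpow_add: "rpow y n (u + v) = rpow y n u + rpow y n v"
  by (induction n) (auto simp: add_left)

lemma rpow_scale: "rpow y n (scale c v) = scale c (rpow y n v)"
  by (induction n) (auto simp: scale_left)

lemma rpow_minus: "rpow y n (- v) = - rpow y n v"
  by (induction n) (auto simp: minus_left)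

lemma rpow_mult_right: "rpow y n (v \<cdot> z) = rpow y n v \<cdot> z"
  by (induction n) (auto simp: right_comm)

lemma rpow_compose: "rpow y m (rpow y n v) = rpow y (m + n) v"
  by (simp add: funpow_add)

lemma rpow_Suc_in_square: "rpow y (Suc n) v \<in> square"
  by (simp add: product_in_square)

lemma rpow_mult_left:
  assumes "u \<in> square"
  shows "x \<cdot> rpow y n u = rpow y n (x \<cdot> u)"
proof (induction n)
  case (Suc n)
  have "rpow y n u \<in> square"
    by (cases n) (use assms in \<open>simp_all add: product_in_square\<close>)
  then show ?case
    using Suc by (simp add: left_right_commute_on_square)
qed simp

text \<open>A partial Fitting decomposition, to be refined by one right multiplication at a time;
  nilpotency on \<open>A0\<close> is therefore left out.\<close>

definition splitting :: "'v set \<Rightarrow> 'v set \<Rightarrow> bool"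
  where "splitting A0 A1 \<longleftrightarrow>
    subspace A0 \<and> subspace A1 \<and> A0 \<inter> A1 = {0} \<and> (\<forall>v. \<exists>a\<in>A0. \<exists>c\<in>A1. v = a + c) \<and>
    A1 \<subseteq> square \<and> (\<forall>a\<in>A0. \<forall>y. a \<cdot> y \<in> A0) \<and> (\<forall>c\<in>A1. \<forall>y. c \<cdot> y \<in> A1 \<and> y \<cdot> c \<in> A1)"

lemma splittingD:
  assumes "splitting A0 A1"
  shows "subspace A0" "subspace A1" "A0 \<inter> A1 = {0}" "\<exists>a\<in>A0. \<exists>c\<in>A1. v = a + c"
    "A1 \<subseteq> square" "a \<in> A0 \<Longrightarrow> a \<cdot> y \<in> A0" "c \<in> A1 \<Longrightarrow> c \<cdot> y \<in> A1" "c \<in> A1 \<Longrightarrow> y \<cdot> c \<in> A1"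
  using assms unfolding splitting_def by blast+

lemma splitting_trivial: "splitting UNIV {0}"
  by (auto simp: splitting_def subspace_square subspace_0 intro: exI[of _ 0])

text \<open>Fitting's lemma for \<open>R(y)\<close> on \<open>A0\<close>: for large
  \<open>n\<close>, \<open>A0\<close> is the sum of the kernel and the image of
  \<open>R(y)^n\<close>. The kernel is kept, and the image is moved into the second summand.\<close>

lemma splitting_refine:
  assumes sp: "splitting A0 A1"
  shows "\<exists>n B1. splitting {v \<in> A0. rpow y n v = 0} B1"
proof -
  note S = splittingD[OF sp]
  have rpow_A0: "rpow y n a \<in> A0" if "a \<in> A0" for n a
    using that by (induction n) (auto intro: S(6))
  have rpow_A1: "rpow y n c \<in> A1" if "c \<in> A1" for n c
    using that by (induction n) (auto intro: S(7))
  have subI: "subspace (rpow y n ` A0)" for n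
  proof (rule subspaceI)
    show "0 \<in> rpow y n ` A0"
      using subspace_0[OF S(1)] by (metis image_eqI rpow_zero)
  qed (auto simp flip: rpow_add rpow_scale intro: subspace_add[OF S(1)] subspace_scale[OF S(1)])
  have subK: "subspace {v. rpow y n v = 0}" for n
    by (rule subspaceI) (auto simp: rpow_add rpow_scale)
  have "rpow y (Suc n) ` A0 \<subseteq> rpow y n ` A0" for n
    using S(6) by (auto simp flip: rpow_mult_right)
  then obtain N1 where N1: "\<And>n. n \<ge> N1 \<Longrightarrow> rpow y n ` A0 = rpow y N1 ` A0"
    using decseq_subspaces_stabilize[of "\<lambda>n. rpow y n ` A0"] subI by blast
  have "{v. rpow y n v = 0} \<subseteq> {v. rpow y (Suc n) v = 0}" for n
    by auto
  then obtain N2 where N2: "\<And>n. n \<ge> N2 \<Longrightarrow> {v. rpow y n v = 0} = {v. rpow y N2 v = 0}"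
    using incseq_subspaces_stabilize[of "\<lambda>n. {v. rpow y n v = 0}"] subK by blast
  define m where "m = max N1 N2"
  \<comment> \<open>Both chains are stable from \<open>m\<close> on. The spare factor in
    \<open>R(y)^n a = R(y)^m (a \<cdot> y)\<close> puts the argument into \<open>square\<close>,
    where left multiplications pass through \<open>R(y)^m\<close>.\<close>
  define n where "n = Suc m"
  have image_stable: "rpow y k ` A0 = rpow y n ` A0" if "k \<ge> m" for k
    using N1[of k] N1[of n] that by (auto simp: m_def n_def)
  have "n \<ge> N2"
    by (simp add: m_def n_def)
  then have "{v. rpow y (n + n) v = 0} = {v. rpow y n v = 0}"
    using N2[of n] N2[of "n + n"] by simp
  then have kernel_stable: "rpow y n v = 0" if "rpow y (n + n) v = 0" for v
    using that by blast
  define B0 where "B0 = {v \<in> A0. rpow y n v = 0}"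
  define B1 where "B1 = {a + c | a c. a \<in> rpow y n ` A0 \<and> c \<in> A1}"
  have B1I: "rpow y n a + c \<in> B1" if "a \<in> A0" "c \<in> A1" for a c
    using that by (auto simp: B1_def)
  \<comment> \<open>Here \<open>v\<close> is arbitrary, since a left multiplication may lead out of
    \<open>A0\<close>.\<close>
  have B1I': "rpow y k v \<in> B1" if "k \<ge> m" for k v
  proof -
    obtain a c where v: "a \<in> A0" "c \<in> A1" "v = a + c"
      using S(4)[of v] by blast
    have "rpow y k a \<in> rpow y n ` A0"
      using v image_stable[OF that] by blast
    then show ?thesis
      using v rpow_A1 by (auto simp: B1_def rpow_add)
  qed
  have "splitting B0 B1"
    unfolding splitting_def
  proof (intro conjI ballI allI)
    show "subspace B0"
      using subspace_inter[OF S(1) subK[of n]] by (simp add: B0_def Collect_conj_eq)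
    show "subspace B1"
      using subspace_sums[OF subI[of n] S(2)] by (simp add: B1_def)
    show "B0 \<inter> B1 = {0}"
    proof (intro equalityI subsetI)
      fix v assume "v \<in> B0 \<inter> B1"
      then obtain a c where v: "v \<in> A0" "rpow y n v = 0" "a \<in> A0" "c \<in> A1" "v = rpow y n a + c"
        by (auto simp: B0_def B1_def)
      have "c = v - rpow y n a"
        using v by simp
      then have "c \<in> A0"
        using v(1,3) rpow_A0 subspace_diff[OF S(1)] by metis
      then have "c = 0"
        using v S(3) by blast
      \<comment> \<open>Now \<open>v = R(y)^n a\<close> is killed by \<open>R(y)^n\<close>, so
        \<open>R(y)^(2n) a = 0\<close> and already \<open>R(y)^n a = 0\<close>.\<close>
      then show "v \<in> {0}"
        using v kernel_stable[of a] by (simp add: rpow_compose)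
    qed (use subspace_0[OF \<open>subspace B0\<close>] subspace_0[OF \<open>subspace B1\<close>] in auto)
    show "\<exists>a\<in>B0. \<exists>c\<in>B1. v = a + c" for v
    proof -
      obtain a c where v: "a \<in> A0" "c \<in> A1" "v = a + c"
        using S(4)[of v] by blast
      \<comment> \<open>As the image is stable, \<open>R(y)^n a = R(y)^(2n) w\<close> for some
        \<open>w\<close>, and \<open>R(y)^n w\<close> is the image part of \<open>a\<close>.\<close>
      have "rpow y n a \<in> rpow y (n + n) ` A0"
        using v image_stable[of "n + n"] by (auto simp: n_def)
      then obtain w where w: "w \<in> A0" "rpow y n a = rpow y (n + n) w"
        by blast
      have "a - rpow y n w \<in> B0"
        using w v rpow_A0 subspace_diff[OF S(1)] rpow_add[of n y "a" "- rpow y n w"]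
        by (simp add: B0_def rpow_minus rpow_compose)
      moreover have "v = (a - rpow y n w) + (rpow y n w + c)"
        using v by simp
      ultimately show ?thesis
        using B1I w v by blast
    qed
    show "B1 \<subseteq> square"
      using S(5) rpow_Suc_in_square[of m y] subspace_add[OF subspace_square]
      by (fastforce simp: B1_def n_def simp del: funpow.simps)
    show "a \<cdot> z \<in> B0" if "a \<in> B0" for a z
      using that S(6) by (auto simp: B0_def rpow_mult_right)
    show "c \<cdot> z \<in> B1" if c_B1: "c \<in> B1" for c z
    proof -
      obtain a d where c: "a \<in> A0" "d \<in> A1" "c = rpow y n a + d"
        using c_B1 by (auto simp: B1_def)
      then show ?thesis
        using B1I[of "a \<cdot> z" "d \<cdot> z"] S(6,7) by (simp add: add_left rpow_mult_right)
    qed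
    show "z \<cdot> c \<in> B1" if c_B1: "c \<in> B1" for c z
    proof -
      obtain a d where c: "a \<in> A0" "d \<in> A1" "c = rpow y n a + d"
        using c_B1 by (auto simp: B1_def)
      have "z \<cdot> rpow y n a = rpow y m (z \<cdot> (a \<cdot> y))"
        using rpow_mult_left[OF product_in_square, of z m y a y] by (simp add: n_def rpow_mult_right)
      then have "z \<cdot> rpow y n a \<in> B1"
        using B1I' by simp
      moreover have "z \<cdot> d \<in> B1"
        using B1I[of 0 "z \<cdot> d"] subspace_0[OF S(1)] S(8) c by simp
      ultimately show ?thesis
        using c subspace_add[OF \<open>subspace B1\<close>] by (simp add: add_right)
    qed
  qed
  then show ?thesis
    unfolding B0_def by blast
qed

text \<open>
  A right multiplication that is not nilpotent on \<open>A0\<close> would refine the splitting to one with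
  a smaller \<open>A0\<close>, so the splitting with \<open>A0\<close> of least dimension will do.
\<close>

lemma fitting_splitting:
  "\<exists>A0 A1. splitting A0 A1 \<and> (\<forall>y. \<exists>n. \<forall>v\<in>A0. rpow y n v = 0)"
proof -
  obtain A where A: "splitting (fst A) (snd A)"
    and least: "\<And>B. splitting (fst B) (snd B) \<Longrightarrow> dim (fst A) \<le> dim (fst B)"
    using ex_has_least_nat[of "\<lambda>A. splitting (fst A) (snd A)" "(UNIV, {0})" "\<lambda>A. dim (fst A)"]
      splitting_trivial by (metis fst_conv snd_conv)
  have "\<exists>n. \<forall>v\<in>fst A. rpow y n v = 0" for y
  proof -
    obtain n B1 where B: "splitting {v \<in> fst A. rpow y n v = 0} B1"
      using splitting_refine[OF A] by blast
    have "{v \<in> fst A. rpow y n v = 0} = fst A"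
      using least[of "({v \<in> fst A. rpow y n v = 0}, B1)"] B
      by (intro subspace_dim_equal splittingD(1)[OF A] splittingD(1)[OF B]) auto
    then show ?thesis
      by blast
  qed
  then show ?thesis
    using A by blast
qed

section \<open>The complete product\<close>

lemma splitting_projections:
  assumes "splitting A0 A1"
  obtains f g where "\<And>v. f v \<in> A0" "\<And>v. g v \<in> A1" "\<And>v. v = f v + g v"
    "\<And>a c. a \<in> A0 \<Longrightarrow> c \<in> A1 \<Longrightarrow> f (a + c) = a"
    "\<And>a c. a \<in> A0 \<Longrightarrow> c \<in> A1 \<Longrightarrow> g (a + c) = c"
proof -
  note S = splittingD[OF assms]
  obtain f g where fg: "\<And>v. f v \<in> A0" "\<And>v. g v \<in> A1" "\<And>v. v = f v + g v"
    using S(4) by metis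
  have "f (a + c) = a \<and> g (a + c) = c" if "a \<in> A0" "c \<in> A1" for a c
  proof -
    have eq: "f (a + c) - a = c - g (a + c)"
      using fg(3)[of "a + c"] by (simp add: algebra_simps)
    have "f (a + c) - a \<in> A0" "c - g (a + c) \<in> A1"
      using that fg S(1,2) subspace_diff by blast+
    then have "f (a + c) - a \<in> A0 \<inter> A1"
      unfolding eq by blast
    then have "f (a + c) - a = 0"
      using S(3) by blast
    then show ?thesis
      using eq by simp
  qed
  then show ?thesis
    using that fg by blast
qed

theorem complete_product_exists:
  "\<exists>q. complete_LR_structure scale (\<lambda>x y. x \<cdot> y - y \<cdot> x) q"
proof -
  obtain A0 A1 where sp: "splitting A0 A1" and nil: "\<And>y. \<exists>n. \<forall>v\<in>A0. rpow y n v = 0"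
    using fitting_splitting by blast
  note S = splittingD[OF sp]
  obtain f g where f: "\<And>v. f v \<in> A0" and g: "\<And>v. g v \<in> A1" and fg: "\<And>v. v = f v + g v"
    and f_eq: "\<And>a c. a \<in> A0 \<Longrightarrow> c \<in> A1 \<Longrightarrow> f (a + c) = a"
    and g_eq: "\<And>a c. a \<in> A0 \<Longrightarrow> c \<in> A1 \<Longrightarrow> g (a + c) = c"
    using splitting_projections[OF sp] by metis
  have A01: "a \<cdot> c = 0" if "a \<in> A0" "c \<in> A1" for a c
    using that S(3,6,8) by blast
  have A11: "c \<cdot> d = d \<cdot> c" if "c \<in> A1" "d \<in> A1" for c d
    using that S(5) square_commute by blast
  have add: "f (x + y) = f x + f y \<and> g (x + y) = g x + g y" for x y
  proof -
    have "x + y = (f x + f y) + (g x + g y)"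
      using fg[of x] fg[of y] by (simp add: algebra_simps)
    then show ?thesis
      using f_eq[of "f x + f y" "g x + g y"] g_eq[of "f x + f y" "g x + g y"]
        f g S(1,2) subspace_add by metis
  qed
  have scl: "f (scale c x) = scale c (f x) \<and> g (scale c x) = scale c (g x)" for c x
  proof -
    have "scale c x = scale c (f x) + scale c (g x)"
      using fg[of x] by (metis scale_right_distrib)
    then show ?thesis
      using f_eq[of "scale c (f x)" "scale c (g x)"] g_eq[of "scale c (f x)" "scale c (g x)"]
        f g S(1,2) subspace_scale by metis
  qed
  define q where "q x y = f x \<cdot> f y - g y \<cdot> f x" for x y
  have q_parts: "f (q x y) = f x \<cdot> f y \<and> g (q x y) = - (g y \<cdot> f x)" for x y
  proof -
    have "f x \<cdot> f y \<in> A0" "- (g y \<cdot> f x) \<in> A1"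
      using f g S(2,6,7) subspace_neg by blast+
    from f_eq[OF this] g_eq[OF this] show ?thesis
      by (simp add: q_def)
  qed
  have bil: "bilinear_map scale q"
    unfolding bilinear_map_def Vector_Spaces.linear_iff
    using vector_space_axioms
    by (auto simp: q_def add scl add_left add_right scale_left scale_right
        scale_right_diff_distrib)
  \<comment> \<open>Both sides expand to \<open>f x \<cdot> (f y \<cdot> f z) + (g z \<cdot> f y)
    \<cdot> f x\<close>, up to exchanging \<open>x\<close> and \<open>y\<close>.\<close>
  have left: "q x (q y z) = q y (q x z)" for x y z
    using left_comm[of "f x" "f y" "f z"] right_comm[of "g z" "f y" "f x"]
    by (simp add: q_def[of x "q y z"] q_def[of y "q x z"] q_parts minus_left)
  \<comment> \<open>By \<open>left_comm\<close> this product is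
    \<open>f x \<cdot> (g z \<cdot> f y)\<close>, which lies in
    \<open>A0 \<cdot> A1 = 0\<close>.\<close>
  have "g z \<cdot> (f x \<cdot> f y) = 0" for x y z
    using left_comm[of "g z" "f x" "f y"] A01 f g S(7) by simp
  then have right: "q (q x y) z = q (q x z) y" for x y z
    by (simp add: q_def[of "q x y" z] q_def[of "q x z" y] q_parts right_comm[of _ "f y"])
  have comm: "q x y - q y x = x \<cdot> y - y \<cdot> x" for x y
  proof -
    have 1: "x \<cdot> y = f x \<cdot> f y + g x \<cdot> f y + g x \<cdot> g y" for x y
    proof -
      have "x \<cdot> y = (f x + g x) \<cdot> (f y + g y)"
        using fg by metis
      then show ?thesis
        using A01[OF f g, of x y] by (simp add: add_left add_right algebra_simps)
    qed
    \<comment> \<open>The terms \<open>g x \<cdot> g y\<close> cancel in the commutator because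
      \<open>A1\<close> is commutative.\<close>
    show ?thesis
      using A11[OF g g, of x y] by (simp add: q_def 1[of x y] 1[of y x])
  qed
  have "nilpotent_map (\<lambda>y. q y w)" for w
  proof -
    obtain n where n: "\<And>v. v \<in> A0 \<Longrightarrow> rpow (f w) n v = 0"
      using nil[of "f w"] by blast
    \<comment> \<open>The projection \<open>f\<close> intertwines right
      \<open>q\<close>-multiplication by \<open>w\<close> with \<open>R(f w)\<close>, so
      \<open>n\<close> steps kill the \<open>A0\<close> part. As \<open>q y w\<close> depends on
      \<open>y\<close> only through \<open>f y\<close>, one further step gives zero.\<close>
    have "f (((\<lambda>y. q y w) ^^ k) y) = rpow (f w) k (f y)" for k y
      by (induction k) (auto simp: q_parts)
    then have "((\<lambda>y. q y w) ^^ Suc n) y = 0" for y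
      by (simp add: q_def[of _ w] n f)
    then show ?thesis
      unfolding nilpotent_map_def by blast
  qed
  then have "complete_LR_structure scale (\<lambda>x y. x \<cdot> y - y \<cdot> x) q"
    unfolding complete_LR_structure_def LR_structure_def LR_algebra_def
    using bil left right comm by blast
  then show ?thesis
    by blast
qed

end

theorem mainTheorem10:
  fixes scale :: "'k::field_char_0 \<Rightarrow> 'v::ab_group_add \<Rightarrow> 'v"
    and br :: "'v \<Rightarrow> 'v \<Rightarrow> 'v"
  assumes "finite_dim_space scale"
    and "lie_algebra scale br"
    and "\<exists>p. LR_structure scale br p"
  shows "\<exists>q. complete_LR_structure scale br q"
proof -
  obtain p where p: "LR_structure scale br p"
    using assms(3) by blast
  interpret vector_space scale
    using assms(1) by (simp add: finite_dim_space_def)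
  obtain S where S: "finite S" "span S = UNIV"
    using assms(1) by (auto simp: finite_dim_space_def)
  \<comment> \<open>The locale asks for a finite basis, so one is extracted from the finite spanning
    set.\<close>
  obtain B where B: "B \<subseteq> S" "independent B" "S \<subseteq> span B"
    using maximal_independent_subset[of S] by blast
  have "finite B" "span B = UNIV"
    using B S finite_subset span_mono[of S "span B"] by (auto simp: span_span)
  with B(2) interpret finite_dimensional_vector_space scale B
    by unfold_locales auto
  interpret finite_dim_LR_algebra scale B p
    using p by unfold_locales
      (auto simp: LR_structure_def LR_algebra_def bilinear_map_def Vector_Spaces.linear_iff)
  have "br = (\<lambda>x y. p x y - p y x)"
    using p by (auto simp: LR_structure_def)
  then show ?thesis
    using complete_product_exists by simp
qed

end
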